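(* For every integer $k>3$ there exists a finite set $K\subset\mathbb{Z}$ of cardinality $k$ such that $K$ is p-arithmetic in $\mathbb{Z}$ but $K$ is not a tile of $\mathbb{Z}$.
   Context: A finite set $K\subset\mathbb{Z}$ is a tile of $\mathbb{Z}$ if there is a subset $C\subseteq\mathbb{Z}$ such that $\mathbb{Z}=\bigsqcup_{c\in C}(c+K)$ (disjoint union). Subsets $K$ considered are of the form $K=\{s_0,\dots,s_{k-1}\}\subset\mathbb{Z}$ with $0=s_0<s_1<\dots<s_{k-1}$ and generate $\mathbb{Z}$ (i.e. $\gcd(s_1,\dots,s_{k-1})=1$). $A(K)$ denotes the system of equations $\sum_{i=0}^{k-1}x_{n+s_i}=0$ for all $n\in\mathbb{Z}$, in the unknowns $(x_n)_{n\in\mathbb{Z}}$. A solution $(\alpha_n)_{n\in\mathbb{Z}}$ of $A(K)$ is periodic if there exist a finite subset $J\subset\mathbb{Z}$ and a subset $I\subseteq\mathbb{Z}$ such that (i) the sets $h+J$, $h\in I$, are pairwise disjoint with union $\mathbb{Z}$; (ii) $\alpha_{h_1+s}=\alpha_{h_2+s}$ for all $h_1,h_2\in I$ and $s\in J$. $K$ is p-arithmetic in $\mathbb{Z}$ if $A(K)$ has a periodic solution in $\mathbb{C}$ that is not identically zero. *)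

theory Defs
  imports Complex_Main "HOL-Library.Disjoint_Sets"
begin

definition translates_partition :: "int set \<Rightarrow> int set \<Rightarrow> bool" where
  "translates_partition C K \<longleftrightarrow>
     disjoint_family_on (\<lambda>c. (+) c ` K) C \<and> (\<Union>c\<in>C. (+) c ` K) = UNIV"

definition tile :: "int set \<Rightarrow> bool" where
  "tile K \<longleftrightarrow> finite K \<and> (\<exists>C. translates_partition C K)"

(* K = {s_0, ..., s_(k-1)} with 0 = s_0 < s_1 < ... < s_(k-1).  The element 0 does not
   affect the gcd, so Gcd K = 1 says that K generates the group of integers. *)
definition normalized :: "int set \<Rightarrow> bool" where
  "normalized K \<longleftrightarrow> finite K \<and> 0 \<in> K \<and> (\<forall>s\<in>K. 0 \<le> s) \<and> Gcd K = 1"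

definition solution :: "int set \<Rightarrow> (int \<Rightarrow> 'a::comm_monoid_add) \<Rightarrow> bool" where
  "solution K x \<longleftrightarrow> (\<forall>n. (\<Sum>s\<in>K. x (n + s)) = 0)"

(* The set I of translations need not be a subgroup. *)
definition periodic :: "(int \<Rightarrow> 'a) \<Rightarrow> bool" where
  "periodic x \<longleftrightarrow>
     (\<exists>J I. finite J \<and> translates_partition I J \<and>
        (\<forall>h1\<in>I. \<forall>h2\<in>I. \<forall>s\<in>J. x (h1 + s) = x (h2 + s)))"

definition p_arithmetic :: "int set \<Rightarrow> bool" where
  "p_arithmetic K \<longleftrightarrow>
     (\<exists>x :: int \<Rightarrow> complex. solution K x \<and> periodic x \<and> (\<exists>n. x n \<noteq> 0))"

end

theory Submission
  imports Defs
begin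

text \<open>
  If \<open>h \<notin> K\<close> and every \<open>h - s\<close> with \<open>s \<in> K\<close> is a difference of two elements of \<open>K\<close>, then \<open>K\<close>
  is not a tile: next to the translate \<open>c + K\<close>, a translate covering \<open>c + h\<close> must overlap \<open>c + K\<close>.
  For a nonzero solution take the 6-periodic sequence 1, 1, 0, -1, -1, 0 with
  \<open>x (n + 2) = x (n + 1) - x n\<close>.  Its sums over intervals telescope, so \<open>{0..<m} \<union> {m + 1, e}\<close> has it
  as a solution whenever \<open>e \<equiv> 4 (mod 6)\<close>; the hole \<open>h = m\<close> shows that this set is not a tile as soon
  as \<open>m + 2 \<le> e \<le> 2 m + 1\<close>.  Such an \<open>e\<close> exists for \<open>m = 2\<close> and for \<open>m \<ge> 5\<close>, which leaves
  the cardinalities 5 and 6.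
\<close>

lemma not_tile_if_hole:
  assumes "K \<noteq> {}" and "h \<notin> K" and diff: "\<And>s. s \<in> K \<Longrightarrow> \<exists>a\<in>K. \<exists>b\<in>K. h - s = a - b"
  shows "\<not> tile K"
proof
  assume "tile K"
  then obtain C where dis: "disjoint_family_on (\<lambda>c. (+) c ` K) C"
    and cov: "(\<Union>c\<in>C. (+) c ` K) = UNIV"
    unfolding tile_def translates_partition_def by blast
  from cov have "0 \<in> (\<Union>c\<in>C. (+) c ` K)" by simp
  then obtain c where c: "c \<in> C" by blast
  from cov have "c + h \<in> (\<Union>c\<in>C. (+) c ` K)" by simp
  then obtain d s where d: "d \<in> C" "s \<in> K" "c + h = d + s" by blast
  obtain a b where ab: "a \<in> K" "b \<in> K" "h - s = a - b" using diff d by blast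
  \<comment> \<open>If \<open>d = c\<close>, then \<open>h = s\<close> would lie in
    \<open>K\<close>.\<close>
  have "d \<noteq> c" using d \<open>h \<notin> K\<close> by auto
  then have "(+) c ` K \<inter> (+) d ` K = {}"
    using dis c d unfolding disjoint_family_on_def by metis
  moreover have "c + a = d + b" using d ab by simp
  ultimately show False using ab by blast
qed

lemma periodic_if_shift_invariant:
  fixes x :: "int \<Rightarrow> 'a"
  assumes "N > 0" and shift: "\<And>n. x (n + N) = x n"
  shows "periodic x"
proof -
  let ?I = "range ((*) N)"
  have inv_nat: "x (n + N * int i) = x n" for n i
  proof (induction i)
    case (Suc i)
    then show ?case using shift[of "n + N * int i"] by (simp add: algebra_simps)
  qed simp
  have inv: "x (n + N * q) = x n" for n q
  proof (cases "q \<ge> 0")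
    case True
    then show ?thesis using inv_nat[of n "nat q"] by simp
  next
    case False
    \<comment> \<open>For negative \<open>q\<close>, climb from \<open>n + N * q\<close> back up to
      \<open>n\<close> by \<open>- q\<close> periods.\<close>
    then show ?thesis using inv_nat[of "n + N * q" "nat (- q)"] by simp
  qed
  have "translates_partition ?I {0..<N}"
    unfolding translates_partition_def
  proof
    show "disjoint_family_on (\<lambda>c. (+) c ` {0..<N}) ?I"
      unfolding disjoint_family_on_def
    proof (intro ballI impI)
      fix c d assume "c \<in> ?I" "d \<in> ?I" "c \<noteq> d"
      then obtain p q where pq: "c = N * p" "d = N * q" by blast
      show "(+) c ` {0..<N} \<inter> (+) d ` {0..<N} = {}"
      proof (rule ccontr)
        assume "\<not> ?thesis"
        then obtain s t where "c + s = d + t" "s \<in> {0..<N}" "t \<in> {0..<N}" by blast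
        then have st: "N * p + s = N * q + t" "0 \<le> s" "s < N" "0 \<le> t" "t < N"
          using pq by auto
        have "(N * i + r) div N = i" if "0 \<le> r" "r < N" for i r
          using that by simp
        from this[of s p] this[of t q] have "p = q" using st by simp
        then show False using pq \<open>c \<noteq> d\<close> by simp
      qed
    qed
    show "(\<Union>c\<in>?I. (+) c ` {0..<N}) = UNIV"
    proof (intro equalityI subsetI UNIV_I)
      fix n :: int
      have "n = N * (n div N) + n mod N" by simp
      moreover have "n mod N \<in> {0..<N}" using \<open>N > 0\<close> by simp
      ultimately show "n \<in> (\<Union>c\<in>?I. (+) c ` {0..<N})" by blast
    qed
  qed
  moreover have "\<forall>h1\<in>?I. \<forall>h2\<in>?I. \<forall>s\<in>{0..<N}. x (h1 + s) = x (h2 + s)"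
    using inv by (auto simp: add.commute)
  ultimately show ?thesis
    unfolding periodic_def by blast
qed

text \<open>The recurrence has characteristic polynomial X^2 - X + 1, the sixth cyclotomic
  polynomial. So, for \<open>K\<close> in the nonnegative integers, all sums of \<open>hex\<close>
  over shifts of \<open>K\<close> vanish exactly when the polynomial with exponent set
  \<open>K\<close> vanishes at the primitive sixth roots of unity.\<close>

definition hex :: "int \<Rightarrow> complex" where
  "hex n = (if n mod 6 \<in> {0, 1} then 1 else if n mod 6 \<in> {3, 4} then - 1 else 0)"

lemma hex_add_2: "hex (n + 2) = hex (n + 1) - hex n"
proof -
  have "n mod 6 \<in> {0, 1, 2, 3, 4, 5}" by auto
  then show ?thesis
    unfolding hex_def mod_add_left_eq[of n 6, symmetric] by auto
qed

lemma hex_add_3: "hex (n + 3) = - hex n"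
  using hex_add_2[of n] hex_add_2[of "n + 1"] by (simp add: add.assoc)

lemma hex_add_6: "hex (n + 6) = hex n"
  using hex_add_3[of n] hex_add_3[of "n + 3"] by (simp add: add.assoc)

lemma p_arithmetic_if_hex:
  assumes "\<And>n. (\<Sum>s\<in>K. hex (n + s)) = 0"
  shows "p_arithmetic K"
proof -
  have "solution K hex" using assms by (simp add: solution_def)
  moreover have "periodic hex"
    by (rule periodic_if_shift_invariant[of 6]) (simp_all add: hex_add_6)
  moreover have "hex 0 \<noteq> 0" by (simp add: hex_def)
  ultimately show ?thesis unfolding p_arithmetic_def by blast
qed

lemma sum_hex_interval: "(\<Sum>s\<in>{0..<int m}. hex (n + s)) = hex (n + 1) - hex (n + int m + 1)"
proof (induction m)
  case (Suc m)
  have "{0..<int (Suc m)} = insert (int m) {0..<int m}" by auto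
  then show ?case
    using Suc hex_add_2[of "n + int m"] by (simp add: add_ac)
qed simp

text \<open>Modulo 6, \<open>e\<close> is half a period past 1, which flips the sign. Thus
  \<open>e\<close> cancels the boundary term \<open>hex (n + 1)\<close> of the interval sum, while
  \<open>m + 1\<close> cancels the other one.\<close>

lemma hex_add_mod_4: "e mod 6 = 4 \<Longrightarrow> hex (n + e) = - hex (n + 1)"
proof -
  assume e: "e mod 6 = 4"
  have "(n + e) mod 6 = (n + 1 + 3) mod 6"
    using e by presburger
  then have "hex (n + e) = hex (n + 1 + 3)" by (simp only: hex_def)
  then show ?thesis by (simp only: hex_add_3)
qed

lemma exists_interval_example:
  fixes m :: nat
  assumes "m = 2 \<or> m \<ge> 5"
  shows "\<exists>K :: int set. normalized K \<and> card K = m + 2 \<and> p_arithmetic K \<and> \<not> tile K"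
proof -
  obtain e where e: "e mod 6 = 4" "int m + 2 \<le> e" "e \<le> 2 * int m + 1"
  proof -
    \<comment> \<open>For \<open>m\<close> at least 6 the range for \<open>e\<close> holds at least
      six consecutive integers, hence every residue; for \<open>m = 5\<close> it is 7 to 11 and
      contains 10.\<close>
    have "m = 2 \<or> (\<exists>e. e mod 6 = (4::int) \<and> int m + 2 \<le> e \<and> e \<le> 2 * int m + 1)"
      using assms by presburger
    then show ?thesis
      using that[of 4] that by auto
  qed
  define K where "K = insert (int m + 1) (insert e {0..<int m})"
  have "normalized K"
  proof -
    have "Gcd K dvd 1"
      using assms by (intro Gcd_dvd) (auto simp: K_def)
    then have "Gcd K = 1"
      using Gcd_int_greater_eq_0[of K] by simp
    then show ?thesis
      using assms e by (auto simp: normalized_def K_def)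
  qed
  moreover have "card K = m + 2"
    using e by (simp add: K_def)
  moreover have "p_arithmetic K"
  proof (rule p_arithmetic_if_hex)
    show "(\<Sum>s\<in>K. hex (n + s)) = 0" for n
      using e by (simp add: K_def sum_hex_interval hex_add_mod_4 add.assoc)
  qed
  moreover have "\<not> tile K"
  proof (rule not_tile_if_hole[where h = "int m"])
    show "K \<noteq> {}" "int m \<notin> K" using e by (auto simp: K_def)
    fix s assume "s \<in> K"
    then consider "s = 0" | "s = int m + 1" | "s = e" "e = 2 * int m + 1" | "s = e" "e \<le> 2 * int m"
      | "0 < s" "s < int m"
      using e by (fastforce simp: K_def)
    then show "\<exists>a\<in>K. \<exists>b\<in>K. int m - s = a - b"
    proof cases
      case 1
      then have "int m - s = (int m + 1) - 1" "1 \<in> K" using assms by (auto simp: K_def)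
      then show ?thesis unfolding K_def by blast
    next
      case 2
      then have "int m - s = 0 - 1" "0 \<in> K" "1 \<in> K" using assms by (auto simp: K_def)
      then show ?thesis by blast
    next
      case 3
      then have "int m - s = 0 - (int m + 1)" "0 \<in> K" using assms by (auto simp: K_def)
      then show ?thesis unfolding K_def by blast
    next
      case 4
      have "int m - s = (2 * int m + 1 - e) - (int m + 1)" using 4 by simp
      \<comment> \<open>The bounds on \<open>e\<close> place this number between 1 and
        \<open>m - 1\<close>.\<close>
      moreover have "2 * int m + 1 - e \<in> K" using e 4 by (auto simp: K_def)
      ultimately show ?thesis unfolding K_def by blast
    next
      case 5
      then have "int m - s = (int m - s) - 0" "int m - s \<in> K" "0 \<in> K" by (auto simp: K_def)
      then show ?thesis by blast
    qed
  qed
  ultimately show ?thesis by blast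
qed

theorem proposition4p8:
  fixes k :: nat
  assumes "k > 3"
  shows "\<exists>K :: int set. normalized K \<and> card K = k \<and> p_arithmetic K \<and> \<not> tile K"
proof -
  consider "k = 5" | "k = 6" | "k - 2 = 2 \<or> k - 2 \<ge> 5" using assms by linarith
  then show ?thesis
  proof cases
    case 1
    \<comment> \<open>As exponents of a primitive sixth root of unity, 0, 2, 4 give a triangle and
      5, 8 an antipodal pair; each sums to zero.\<close>
    let ?K = "{0, 2, 4, 5, 8} :: int set"
    have "normalized ?K" by (simp add: normalized_def)
    moreover have "p_arithmetic ?K"
    proof (rule p_arithmetic_if_hex)
      show "(\<Sum>s\<in>?K. hex (n + s)) = 0" for n
        using hex_add_2[of "n + 2"] hex_add_3[of "n + 2"] hex_add_3[of "n + 5"] hex_add_2[of n]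
          hex_add_3[of n] hex_add_3[of "n + 1"]
        by (simp add: add.assoc)
    qed
    moreover have "\<not> tile ?K"
      \<comment> \<open>The differences 3, 1, -1, -2, -5 arise as 8 - 5, 5 - 4, 4 - 5, 0 - 2, 0 -
        5.\<close>
      by (rule not_tile_if_hole[where h = 3]) auto
    ultimately show ?thesis using 1 by (intro exI[of _ ?K]) simp
  next
    case 2
    \<comment> \<open>Three antipodal pairs: 0, 3 and 1, 4 and 6, 9.\<close>
    let ?K = "{0, 1, 3, 4, 6, 9} :: int set"
    have "normalized ?K" by (simp add: normalized_def)
    moreover have "p_arithmetic ?K"
    proof (rule p_arithmetic_if_hex)
      show "(\<Sum>s\<in>?K. hex (n + s)) = 0" for n
        using hex_add_3[of n] hex_add_3[of "n + 1"] hex_add_3[of "n + 6"]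
        by (simp add: add.assoc)
    qed
    moreover have "\<not> tile ?K"
      \<comment> \<open>The differences 5, 4, 2, 1, -1, -4 arise as 6 - 1, 4 - 0, 3 - 1, 1 - 0, 0 -
        1, 0 - 4.\<close>
      by (rule not_tile_if_hole[where h = 5]) auto
    ultimately show ?thesis using 2 by (intro exI[of _ ?K]) simp
  next
    case 3
    then have "k - 2 + 2 = k" by auto
    with exists_interval_example[OF 3] show ?thesis by simp
  qed
qed

end
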